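(* Let $\rhd$ be a system of ideals for an ordered group $G$. If $G$ is $\rhd$-closed, then $G$ embeds into the Lorenzen group associated with $\rhd$, i.e. the natural morphism $G\to H$ into the Lorenzen group $H$ is injective and order-reflecting.
   Context: Monoids and groups are commutative. An ordered group is a commutative group $G$ with a partial order $\le_G$ compatible with addition. $\mathrm{P}_{\mathrm{fe}}^*(G)$ is the set of nonempty finite subsets of $G$; $a$ stands for $\{a\}$, $A,A'$ for $A\cup A'$, $x+A=\{x+a\}$, $A-B=\{a-b\}$. A system of ideals for $G$ is a relation $\rhd$ between $\mathrm{P}_{\mathrm{fe}}^*(G)$ and $G$ such that: $a\rhd a$; $A\rhd b\Rightarrow A,A'\rhd b$; ($A\rhd c$ and $A,c\rhd b$) $\Rightarrow A\rhd b$; $a\le_G b\Rightarrow a\rhd b$; $A\rhd b\Rightarrow x+A\rhd x+b$. $\rhd_2$ is coarser than $\rhd_1$ if $A\rhd_1 b$ implies $A\rhd_2 b$. For $y_1,\dots,y_n\in G$, $\rhd_{y_1,\dots,y_n}$ is the finest system of ideals coarser than $\rhd$ with $0\rhd_{y_1,\dots,y_n}y_i$ for all $i$. The regularisation of $\rhd$ is the relation on $\mathrm{P}_{\mathrm{fe}}^*(G)$: $A\vdash_{\rhd}B$ iff there exist $x_1,\dots,x_m\in G$ with $A-B\rhd_{\pm x_1,\dots,\pm x_m}0$ for every choice of signs. $G$ is $\rhd$-closed if $a\vdash_\rhd b$ implies $a\le_G b$ for all $a,b\in G$. The regularisation is an unbounded entailment relation; the distributive lattice $H$ it generates (presented by generators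 the elements of $G$ and relations $\bigwedge A\le\bigvee B$ whenever $A\vdash_\rhd B$, no top or bottom required) carries a unique group law compatible with the lattice operations (addition distributes over $\wedge$ and $\vee$) for which the natural map $G\to H$ is a group morphism; this lattice-ordered group $H$ is the Lorenzen group associated with $\rhd$. *)

theory Defs
  imports "HOL-Algebra.Group"
begin

section \<open>Systems of ideals and their regularisation\<close>

text \<open>An ordered group (commutative, partially ordered, written additively) is a type of class
  \<^class>\<open>ordered_ab_group_add\<close>. A relation between nonempty finite subsets of \<open>G\<close> and \<open>G\<close> is a
  predicate on \<open>'a set\<close> and \<open>'a\<close> that holds only if its first argument is finite and
  nonempty.\<close>

locale system_of_ideals =
  fixes R :: "'a::ordered_ab_group_add set \<Rightarrow> 'a \<Rightarrow> bool"  (infix \<open>\<rhd>\<close> 50)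
  assumes fin_nonempty: "A \<rhd> b \<Longrightarrow> finite A \<and> A \<noteq> {}"
    and reflexive: "{a} \<rhd> a"
    and weakening: "A \<rhd> b \<Longrightarrow> finite A' \<Longrightarrow> A' \<noteq> {} \<Longrightarrow> A \<union> A' \<rhd> b"
    and transitive: "A \<rhd> c \<Longrightarrow> A \<union> {c} \<rhd> b \<Longrightarrow> A \<rhd> b"
    and order: "a \<le> b \<Longrightarrow> {a} \<rhd> b"
    and translation: "A \<rhd> b \<Longrightarrow> (+) x ` A \<rhd> x + b"

definition coarser_than ::
    "('a set \<Rightarrow> 'a \<Rightarrow> bool) \<Rightarrow> ('a set \<Rightarrow> 'a \<Rightarrow> bool) \<Rightarrow> bool" where
  "coarser_than R2 R1 \<longleftrightarrow> (\<forall>A b. R1 A b \<longrightarrow> R2 A b)"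

text \<open>The finest system of ideals coarser than \<open>R\<close> with \<open>0 \<rhd> y\<close> for all \<open>y \<in> Y\<close>, obtained as the
  intersection of all of these; lemma \<open>forced_finest\<close> below justifies the definition.\<close>

definition forced ::
    "('a::ordered_ab_group_add set \<Rightarrow> 'a \<Rightarrow> bool) \<Rightarrow> 'a set \<Rightarrow> 'a set \<Rightarrow> 'a \<Rightarrow> bool" where
  "forced R Y A b \<longleftrightarrow>
     (\<forall>S. system_of_ideals S \<longrightarrow> coarser_than S R \<longrightarrow> (\<forall>y\<in>Y. S {0} y) \<longrightarrow> S A b)"

text \<open>\<open>xs = [x\<^sub>1, \<dots>, x\<^sub>m]\<close>, and \<open>ys = [\<plusminus>x\<^sub>1, \<dots>, \<plusminus>x\<^sub>m]\<close> ranges over all choices of signs.\<close>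

definition regularisation ::
    "('a::ordered_ab_group_add set \<Rightarrow> 'a \<Rightarrow> bool) \<Rightarrow> 'a set \<Rightarrow> 'a set \<Rightarrow> bool" where
  "regularisation R A B \<longleftrightarrow> finite A \<and> A \<noteq> {} \<and> finite B \<and> B \<noteq> {} \<and>
     (\<exists>xs. \<forall>ys. list_all2 (\<lambda>y x. y = x \<or> y = - x) ys xs \<longrightarrow>
        forced R (set ys) {a - b | a b. a \<in> A \<and> b \<in> B} 0)"

definition ideal_closed :: "('a::ordered_ab_group_add set \<Rightarrow> 'a \<Rightarrow> bool) \<Rightarrow> bool" where
  "ideal_closed R \<longleftrightarrow> (\<forall>a b. regularisation R {a} {b} \<longrightarrow> a \<le> b)"


section \<open>The distributive lattice generated by the regularisation\<close>

datatype 'a lterm = Gen 'a | Meet "'a lterm" "'a lterm" | Join "'a lterm" "'a lterm"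

definition meets :: "'a \<Rightarrow> 'a list \<Rightarrow> 'a lterm" where
  "meets a as = foldr (\<lambda>x t. Meet (Gen x) t) as (Gen a)"

definition joins :: "'a \<Rightarrow> 'a list \<Rightarrow> 'a lterm" where
  "joins a as = foldr (\<lambda>x t. Join (Gen x) t) as (Gen a)"

text \<open>The least congruence on lattice terms that contains the axioms of distributive lattices and
  the relations \<open>\<And>A \<le> \<Or>B\<close> (written as \<open>\<And>A \<and> \<Or>B = \<And>A\<close>) for \<open>A \<turnstile> B\<close>, where the nonempty
  finite sets \<open>A\<close> and \<open>B\<close> are enumerated by nonempty lists.\<close>

inductive lz_eq ::
    "('a::ordered_ab_group_add set \<Rightarrow> 'a \<Rightarrow> bool) \<Rightarrow> 'a lterm \<Rightarrow> 'a lterm \<Rightarrow> bool"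
  for R where
  refl: "lz_eq R s s"
| sym: "lz_eq R s t \<Longrightarrow> lz_eq R t s"
| trans: "lz_eq R s t \<Longrightarrow> lz_eq R t u \<Longrightarrow> lz_eq R s u"
| cong_meet: "lz_eq R s s' \<Longrightarrow> lz_eq R t t' \<Longrightarrow> lz_eq R (Meet s t) (Meet s' t')"
| cong_join: "lz_eq R s s' \<Longrightarrow> lz_eq R t t' \<Longrightarrow> lz_eq R (Join s t) (Join s' t')"
| comm_meet: "lz_eq R (Meet s t) (Meet t s)"
| comm_join: "lz_eq R (Join s t) (Join t s)"
| assoc_meet: "lz_eq R (Meet (Meet s t) u) (Meet s (Meet t u))"
| assoc_join: "lz_eq R (Join (Join s t) u) (Join s (Join t u))"
| absorb_meet: "lz_eq R (Meet s (Join s t)) s"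
| absorb_join: "lz_eq R (Join s (Meet s t)) s"
| distrib: "lz_eq R (Meet s (Join t u)) (Join (Meet s t) (Meet s u))"
| relation: "regularisation R (set (a # as)) (set (b # bs)) \<Longrightarrow>
    lz_eq R (Meet (meets a as) (joins b bs)) (meets a as)"

definition lz_rel :: "('a::ordered_ab_group_add set \<Rightarrow> 'a \<Rightarrow> bool) \<Rightarrow> ('a lterm \<times> 'a lterm) set"
  where "lz_rel R = {(s, t). lz_eq R s t}"

definition lz_carrier :: "('a::ordered_ab_group_add set \<Rightarrow> 'a \<Rightarrow> bool) \<Rightarrow> 'a lterm set set" where
  "lz_carrier R = UNIV // lz_rel R"

definition lz_meet :: "('a::ordered_ab_group_add set \<Rightarrow> 'a \<Rightarrow> bool) \<Rightarrow>
    'a lterm set \<Rightarrow> 'a lterm set \<Rightarrow> 'a lterm set" where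
  "lz_meet R X Y = (\<Union>s\<in>X. \<Union>t\<in>Y. lz_rel R `` {Meet s t})"

definition lz_join :: "('a::ordered_ab_group_add set \<Rightarrow> 'a \<Rightarrow> bool) \<Rightarrow>
    'a lterm set \<Rightarrow> 'a lterm set \<Rightarrow> 'a lterm set" where
  "lz_join R X Y = (\<Union>s\<in>X. \<Union>t\<in>Y. lz_rel R `` {Join s t})"

definition lz_gen :: "('a::ordered_ab_group_add set \<Rightarrow> 'a \<Rightarrow> bool) \<Rightarrow> 'a \<Rightarrow> 'a lterm set" where
  "lz_gen R a = lz_rel R `` {Gen a}"


section \<open>The Lorenzen group\<close>

text \<open>The record type \<^typ>\<open>'b monoid\<close> writes groups multiplicatively: for the structures below, \<open>\<otimes>\<close>
  and \<open>\<one>\<close> are the addition and the zero of the group.\<close>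

record 'b lgroup = "'b monoid" +
  lmeet :: "'b \<Rightarrow> 'b \<Rightarrow> 'b"
  ljoin :: "'b \<Rightarrow> 'b \<Rightarrow> 'b"

definition lgroup_le :: "('b, 'c) lgroup_scheme \<Rightarrow> 'b \<Rightarrow> 'b \<Rightarrow> bool" where
  "lgroup_le H x y \<longleftrightarrow> lmeet H x y = x"

definition additive_group :: "'a::ordered_ab_group_add monoid" where
  "additive_group = \<lparr>carrier = UNIV, mult = (+), one = 0\<rparr>"

text \<open>The group laws on the lattice compatible with meet and join for which the natural map is a
  group morphism. Functions are total, so the last clause fixes the value outside the carrier; it
  is needed for uniqueness.\<close>

definition lz_group_law :: "('a::ordered_ab_group_add set \<Rightarrow> 'a \<Rightarrow> bool) \<Rightarrow>
    ('a lterm set \<Rightarrow> 'a lterm set \<Rightarrow> 'a lterm set) \<Rightarrow> bool" where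
  "lz_group_law R f \<longleftrightarrow>
     (let H = \<lparr>carrier = lz_carrier R, mult = f, one = lz_gen R 0\<rparr> in
       comm_group H \<and>
       lz_gen R \<in> hom additive_group H \<and>
       (\<forall>x\<in>carrier H. \<forall>y\<in>carrier H. \<forall>z\<in>carrier H.
          f x (lz_meet R y z) = lz_meet R (f x y) (f x z) \<and>
          f x (lz_join R y z) = lz_join R (f x y) (f x z)) \<and>
       (\<forall>x y. x \<notin> carrier H \<or> y \<notin> carrier H \<longrightarrow> f x y = undefined))"

text \<open>Existence and uniqueness of the law are lemma \<open>lz_group_law_ex1\<close> below.\<close>

definition lorenzen_group ::
    "('a::ordered_ab_group_add set \<Rightarrow> 'a \<Rightarrow> bool) \<Rightarrow> 'a lterm set lgroup" where
  "lorenzen_group R =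
     \<lparr>carrier = lz_carrier R, mult = (THE f. lz_group_law R f), one = lz_gen R 0,
      lmeet = lz_meet R, ljoin = lz_join R\<rparr>"


section \<open>Well-definedness\<close>

lemma system_of_ideals_total:
  "system_of_ideals (\<lambda>A (b::'a::ordered_ab_group_add). finite A \<and> A \<noteq> {})"
  by unfold_locales auto

lemma forced_finest:
  assumes "system_of_ideals R"
  shows "system_of_ideals (forced R Y)" (is ?sys)
    and "coarser_than (forced R Y) R"
    and "y \<in> Y \<Longrightarrow> forced R Y {0} y"
    and "system_of_ideals S \<Longrightarrow> coarser_than S R \<Longrightarrow> \<forall>y\<in>Y. S {0} y \<Longrightarrow> coarser_than S (forced R Y)"
proof -
  interpret system_of_ideals R by fact
  show ?sys
  proof
    fix A b assume *: "forced R Y A b"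
    have "coarser_than (\<lambda>A b. finite A \<and> A \<noteq> {}) R"
      using fin_nonempty by (auto simp: coarser_than_def)
    with * show "finite A \<and> A \<noteq> {}"
      using system_of_ideals_total unfolding forced_def by fastforce
  next
    fix a show "forced R Y {a} a"
      unfolding forced_def using system_of_ideals.reflexive by blast
  next
    fix A A' :: "'a set" and b assume "forced R Y A b" "finite A'" "A' \<noteq> {}"
    then show "forced R Y (A \<union> A') b"
      unfolding forced_def using system_of_ideals.weakening by blast
  next
    fix A c b assume "forced R Y A c" "forced R Y (A \<union> {c}) b"
    then show "forced R Y A b"
      unfolding forced_def using system_of_ideals.transitive by blast
  next
    fix a b :: 'a assume "a \<le> b"
    then show "forced R Y {a} b"
      unfolding forced_def using system_of_ideals.order by blast
  next
    fix A b x assume "forced R Y A b"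
    then show "forced R Y ((+) x ` A) (x + b)"
      unfolding forced_def using system_of_ideals.translation by blast
  qed
qed (auto simp: forced_def coarser_than_def)

context
  fixes R :: "'a::ordered_ab_group_add set \<Rightarrow> 'a \<Rightarrow> bool"
begin

private abbreviation eq (infix \<open>\<approx>\<close> 50) where "eq \<equiv> lz_eq R"
private definition le (infix \<open>\<lesssim>\<close> 50) where "s \<lesssim> t \<longleftrightarrow> Meet s t \<approx> s"

lemmas [trans] = lz_eq.trans

private lemma idem: "Meet s s \<approx> s"
  by (meson absorb_join absorb_meet lz_eq.refl lz_eq.sym lz_eq.trans cong_meet)

private lemma le_refl: "s \<lesssim> s"
  using idem by (simp add: le_def)

private lemma le_trans [trans]: assumes "s \<lesssim> t" "t \<lesssim> u" shows "s \<lesssim> u"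
proof -
  have "Meet s u \<approx> Meet (Meet s t) u"
    using assms(1) lz_eq.refl lz_eq.sym cong_meet unfolding le_def by blast
  also have "\<dots> \<approx> Meet s (Meet t u)" by (rule assoc_meet)
  also have "\<dots> \<approx> Meet s t"
    using assms(2) lz_eq.refl cong_meet unfolding le_def by blast
  also have "\<dots> \<approx> s" using assms(1) by (simp add: le_def)
  finally show ?thesis by (simp add: le_def)
qed

private lemma le_antisym: "s \<lesssim> t \<Longrightarrow> t \<lesssim> s \<Longrightarrow> s \<approx> t"
  unfolding le_def by (meson comm_meet lz_eq.sym lz_eq.trans)

private lemma eq_le: assumes "s \<approx> t" shows "s \<lesssim> t"
proof -
  have "Meet s t \<approx> Meet s s" using assms lz_eq.refl lz_eq.sym cong_meet by blast
  also have "\<dots> \<approx> s" by (rule idem)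
  finally show ?thesis by (simp add: le_def)
qed

private lemma eq_iff: "s \<approx> t \<longleftrightarrow> s \<lesssim> t \<and> t \<lesssim> s"
  using le_antisym eq_le lz_eq.sym by blast

private lemma le_join_def: "s \<lesssim> t \<longleftrightarrow> Join s t \<approx> t"
proof
  assume "s \<lesssim> t"
  then have "Join s t \<approx> Join (Meet s t) t"
    unfolding le_def by (meson lz_eq.refl lz_eq.sym cong_join)
  also have "\<dots> \<approx> Join t (Meet t s)"
    by (meson comm_join comm_meet lz_eq.refl lz_eq.trans cong_join)
  also have "\<dots> \<approx> t" by (rule absorb_join)
  finally show "Join s t \<approx> t" .
next
  assume "Join s t \<approx> t"
  then have "Meet s t \<approx> Meet s (Join s t)"
    by (meson lz_eq.refl lz_eq.sym cong_meet)
  also have "\<dots> \<approx> s" by (rule absorb_meet)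
  finally show "s \<lesssim> t" by (simp add: le_def)
qed

private lemma meet_le2: "Meet s t \<lesssim> t"
  unfolding le_def by (meson assoc_meet idem lz_eq.refl lz_eq.trans cong_meet)

private lemma meet_le1: "Meet s t \<lesssim> s"
  by (meson meet_le2 comm_meet eq_le le_trans)

private lemma le_join1: "s \<lesssim> Join s t"
  unfolding le_def by (rule absorb_meet)

private lemma le_join2: "t \<lesssim> Join s t"
  by (meson le_join1 comm_join eq_le le_trans)

private lemma meet_glb: assumes "u \<lesssim> s" "u \<lesssim> t" shows "u \<lesssim> Meet s t"
proof -
  have "Meet u (Meet s t) \<approx> Meet (Meet u s) t" by (rule lz_eq.sym, rule assoc_meet)
  also have "\<dots> \<approx> Meet u t" using assms(1) lz_eq.refl cong_meet unfolding le_def by blast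
  also have "\<dots> \<approx> u" using assms(2) by (simp add: le_def)
  finally show ?thesis by (simp add: le_def)
qed

private lemma join_lub: assumes "s \<lesssim> u" "t \<lesssim> u" shows "Join s t \<lesssim> u"
proof -
  have "Join (Join s t) u \<approx> Join s (Join t u)" by (rule assoc_join)
  also have "\<dots> \<approx> Join s u" using assms(2) lz_eq.refl cong_join unfolding le_join_def by blast
  also have "\<dots> \<approx> u" using assms(1) by (simp add: le_join_def)
  finally show ?thesis by (simp add: le_join_def)
qed

private lemma le_meet_iff: "u \<lesssim> Meet s t \<longleftrightarrow> u \<lesssim> s \<and> u \<lesssim> t"
  by (meson meet_glb meet_le1 meet_le2 le_trans)

private lemma join_le_iff: "Join s t \<lesssim> u \<longleftrightarrow> s \<lesssim> u \<and> t \<lesssim> u"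
  by (meson join_lub le_join1 le_join2 le_trans)

private lemma meet_mono: "s \<lesssim> s' \<Longrightarrow> t \<lesssim> t' \<Longrightarrow> Meet s t \<lesssim> Meet s' t'"
  by (meson meet_glb meet_le1 meet_le2 le_trans)

private lemma join_mono: "s \<lesssim> s' \<Longrightarrow> t \<lesssim> t' \<Longrightarrow> Join s t \<lesssim> Join s' t'"
  by (meson join_lub le_join1 le_join2 le_trans)

private lemma distrib_meet_le: "Meet s (Join t u) \<lesssim> Join (Meet s t) (Meet s u)"
  by (rule eq_le, rule distrib)

private lemma distrib_join_le: "Meet (Join q y) (Join q' y) \<lesssim> Join (Meet q q') y"
proof -
  have "Meet (Join q y) (Join q' y) \<lesssim> Join (Meet (Join q y) q') (Meet (Join q y) y)"
    by (rule distrib_meet_le)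
  also have "\<dots> \<lesssim> Join (Meet q q') y"
  proof (rule join_lub)
    have "Meet (Join q y) q' \<lesssim> Meet q' (Join q y)" by (rule eq_le, rule comm_meet)
    also have "\<dots> \<lesssim> Join (Meet q' q) (Meet q' y)" by (rule distrib_meet_le)
    also have "\<dots> \<lesssim> Join (Meet q q') y"
      by (meson join_mono meet_le1 meet_le2 meet_glb)
    finally show "Meet (Join q y) q' \<lesssim> Join (Meet q q') y" .
    show "Meet (Join q y) y \<lesssim> Join (Meet q q') y"
      by (meson meet_le2 le_join2 le_trans)
  qed
  finally show ?thesis .
qed

text \<open>Addition on terms, by distributivity in the second argument; \<open>shift b\<close> adds \<open>Gen b\<close>.\<close>

private primrec shift :: "'a \<Rightarrow> 'a lterm \<Rightarrow> 'a lterm" where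
  "shift b (Gen a) = Gen (b + a)"
| "shift b (Meet s t) = Meet (shift b s) (shift b t)"
| "shift b (Join s t) = Join (shift b s) (shift b t)"

private primrec add :: "'a lterm \<Rightarrow> 'a lterm \<Rightarrow> 'a lterm" where
  "add s (Gen b) = shift b s"
| "add s (Meet t u) = Meet (add s t) (add s u)"
| "add s (Join t u) = Join (add s t) (add s u)"

private primrec neg :: "'a lterm \<Rightarrow> 'a lterm" where
  "neg (Gen b) = Gen (- b)"
| "neg (Meet t u) = Join (neg t) (neg u)"
| "neg (Join t u) = Meet (neg t) (neg u)"

private lemma shift_meets: "shift b (meets a as) = meets (b + a) (map ((+) b) as)"
  unfolding meets_def by (induction as) auto

private lemma shift_joins: "shift b (joins a as) = joins (b + a) (map ((+) b) as)"
  unfolding joins_def by (induction as) auto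

private lemma regularisation_shift:
  assumes "regularisation R A B"
  shows "regularisation R ((+) x ` A) ((+) x ` B)"
proof -
  have "{a - b | a b. a \<in> (+) x ` A \<and> b \<in> (+) x ` B} = {a - b | a b. a \<in> A \<and> b \<in> B}"
    by (auto simp: image_iff) (metis add_diff_cancel_left)+
  with assms show ?thesis
    unfolding regularisation_def by simp
qed

private lemma shift_cong: "s \<approx> t \<Longrightarrow> shift b s \<approx> shift b t"
proof (induction rule: lz_eq.induct)
  case (relation a as c cs)
  from regularisation_shift[OF this, of b] show ?case
    using lz_eq.relation[of R "b + a" "map ((+) b) as" "b + c" "map ((+) b) cs"]
    by (simp add: shift_meets shift_joins)
qed (auto intro: lz_eq.intros)

private lemma add_cong1: "s \<approx> s' \<Longrightarrow> add s t \<approx> add s' t"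
  by (induction t) (auto intro: shift_cong cong_meet cong_join)

private lemma shift_shift: "shift c (shift b s) = shift (c + b) s"
  by (induction s) (auto simp: add.assoc)

private lemma add_shift: "shift c (add s t) = add s (shift c t)"
  by (induction t) (auto simp: shift_shift)

private lemma add_assoc: "add (add s t) u = add s (add t u)"
  by (induction u) (auto simp: add_shift)

private lemma add_Gen: "add (Gen b) s = shift b s"
  by (induction s) (auto simp: add.commute)

private lemma shift_zero: "shift 0 s = s"
  by (induction s) auto

private lemma add_zero: "add s (Gen 0) = s"
  by (simp add: shift_zero)

text \<open>Compatibility of addition with the lattice structure rests on
  \<open>a + c, b + d \<turnstile> b + c, a + d\<close>.\<close>

context
  assumes sys: "system_of_ideals R"
begin

private lemma regular: "regularisation R {a + c, b + d} {b + c, a + d}"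
proof -
  define D where "D = {u - v | u v. u \<in> {a + c, b + d} \<and> v \<in> {b + c, a + d}}"
  have finD: "finite D"
  proof -
    have "D \<subseteq> (\<lambda>(u, v). u - v) ` ({a + c, b + d} \<times> {b + c, a + d})"
      unfolding D_def by auto
    then show ?thesis by (rule finite_subset) auto
  qed
  have "(a + c) - (b + c) = a - b" "(b + d) - (a + d) = - (a - b)"
    by (simp_all add: algebra_simps)
  then have inD: "a - b \<in> D" "- (a - b) \<in> D" unfolding D_def by (metis (mono_tags, lifting) insertCI mem_Collect_eq)+
  have "forced R (set ys) D 0"
    if "list_all2 (\<lambda>y x. y = x \<or> y = - x) ys [a - b]" for ys
  proof -
    from that obtain y where ys: "ys = [y]" and y: "y = a - b \<or> y = - (a - b)"
      by (auto simp: list_all2_Cons2)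
    interpret F: system_of_ideals "forced R (set ys)"
      by (rule forced_finest(1)[OF sys])
    have "forced R (set ys) {0} y"
      using forced_finest(3)[OF sys, of y "set ys"] ys by simp
    from F.translation[OF this, of "- y"] have "forced R (set ys) {- y} 0" by simp
    from F.weakening[OF this finD] inD have "forced R (set ys) ({- y} \<union> D) 0" by auto
    moreover have "{- y} \<union> D = D" using y inD by auto
    ultimately show ?thesis by simp
  qed
  then show ?thesis
    unfolding regularisation_def D_def[symmetric] by blast
qed

private lemma regular_gen:
  "Meet (Gen (a + c)) (Gen (b + d)) \<lesssim> Join (Gen (b + c)) (Gen (a + d))"
proof -
  have "Meet (meets (a + c) [b + d]) (joins (b + c) [a + d]) \<approx> meets (a + c) [b + d]"
    by (rule lz_eq.relation) (simp add: regular)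
  then have "Meet (Gen (b + d)) (Gen (a + c)) \<lesssim> Join (Gen (a + d)) (Gen (b + c))"
    by (simp add: le_def meets_def joins_def)
  then show ?thesis
    by (meson comm_meet comm_join eq_le le_trans)
qed

text \<open>\<open>cross x p q y\<close> is closed under meets and joins taken simultaneously in \<open>x\<close> and \<open>q\<close>, and,
  symmetrically, in \<open>p\<close> and \<open>y\<close>.\<close>

private definition cross where "cross x p q y \<longleftrightarrow> Meet x p \<lesssim> Join q y"

private lemma cross_swap: "cross x p q y \<longleftrightarrow> cross p x y q"
  unfolding cross_def by (meson comm_meet comm_join eq_le le_trans)

private lemma cross_comm_left: "cross x p q y \<longleftrightarrow> cross p x q y"
  unfolding cross_def by (meson comm_meet eq_le le_trans)

private lemma cross_comm_right: "cross x p q y \<longleftrightarrow> cross x p y q"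
  unfolding cross_def by (meson comm_join eq_le le_trans)

private lemma cross_le: "cross x p q y \<Longrightarrow> x' \<lesssim> x \<Longrightarrow> q \<lesssim> q' \<Longrightarrow> cross x' p q' y"
  unfolding cross_def by (meson le_trans meet_mono join_mono le_refl)

private lemma cross_meet:
  assumes "cross x p q y" "cross x' p q' y"
  shows "cross (Meet x x') p (Meet q q') y"
proof -
  have "Meet (Meet x x') p \<lesssim> Join q y"
    using assms(1) unfolding cross_def by (meson meet_mono meet_le1 le_refl le_trans)
  moreover have "Meet (Meet x x') p \<lesssim> Join q' y"
    using assms(2) unfolding cross_def by (meson meet_mono meet_le2 le_refl le_trans)
  ultimately show ?thesis
    unfolding cross_def by (meson meet_glb distrib_join_le le_trans)
qed

private lemma cross_join:
  assumes "cross x p q y" "cross x' p q' y"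
  shows "cross (Join x x') p (Join q q') y"
proof -
  have "Meet (Join x x') p \<lesssim> Meet p (Join x x')" by (rule eq_le, rule comm_meet)
  also have "\<dots> \<lesssim> Join (Meet p x) (Meet p x')" by (rule distrib_meet_le)
  also have "\<dots> \<lesssim> Join (Join q q') y"
  proof (rule join_lub)
    show "Meet p x \<lesssim> Join (Join q q') y"
      using assms(1) unfolding cross_def
      by (meson comm_meet eq_le join_mono le_join1 le_refl le_trans)
    show "Meet p x' \<lesssim> Join (Join q q') y"
      using assms(2) unfolding cross_def
      by (meson comm_meet eq_le join_mono le_join2 le_refl le_trans)
  qed
  finally show ?thesis by (simp add: cross_def)
qed

private lemma cross_shift: "cross (shift a t) (shift b u) (shift b t) (shift a u)"
proof (induction t)
  case (Gen c)
  show ?case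
  proof (induction u)
    case (Gen d)
    show ?case using regular_gen by (simp add: cross_def)
  next
    case (Meet u u')
    then show ?case using cross_meet cross_swap by (metis shift.simps(2))
  next
    case (Join u u')
    then show ?case using cross_join cross_swap by (metis shift.simps(3))
  qed
qed (simp_all add: cross_meet cross_join)

private definition additive where
  "additive t \<longleftrightarrow> (\<forall>s s'. add (Meet s s') t \<approx> Meet (add s t) (add s' t) \<and>
                         add (Join s s') t \<approx> Join (add s t) (add s' t))"

private lemma cross_add:
  assumes "additive t" "additive u"
  shows "cross (add s t) (add s' u) (add s' t) (add s u)"
proof -
  have meet_t: "add (Meet s s') t \<approx> Meet (add s t) (add s' t)"
    and join_t: "add (Join s s') t \<approx> Join (add s t) (add s' t)"
    and meet_u: "add (Meet s s') u \<approx> Meet (add s u) (add s' u)"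
    and join_u: "add (Join s s') u \<approx> Join (add s u) (add s' u)" for s s'
    using assms unfolding additive_def by blast+
  show ?thesis
  proof (induction s)
    case (Gen a)
    show ?case
    proof (induction s')
      case (Gen b)
      show ?case using cross_shift by (simp add: add_Gen)
    next
      case (Meet s s')
      then have "cross (Meet (add s u) (add s' u)) (add (Gen a) t) (Meet (add s t) (add s' t)) (add (Gen a) u)"
        by (intro cross_meet) (simp_all add: cross_comm_left)
      then have "cross (add (Meet s s') u) (add (Gen a) t) (add (Meet s s') t) (add (Gen a) u)"
        by (rule cross_le) (use meet_t meet_u eq_iff in blast)+
      then show ?case by (simp add: cross_comm_left)
    next
      case (Join s s')
      then have "cross (Join (add s u) (add s' u)) (add (Gen a) t) (Join (add s t) (add s' t)) (add (Gen a) u)"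
        by (intro cross_join) (simp_all add: cross_comm_left)
      then have "cross (add (Join s s') u) (add (Gen a) t) (add (Join s s') t) (add (Gen a) u)"
        by (rule cross_le) (use join_t join_u eq_iff in blast)+
      then show ?case by (simp add: cross_comm_left)
    qed
  next
    case (Meet r r')
    then have "cross (Meet (add r t) (add r' t)) (add s' u) (Meet (add r u) (add r' u)) (add s' t)"
      by (intro cross_meet) (simp_all add: cross_comm_right)
    then have "cross (add (Meet r r') t) (add s' u) (add (Meet r r') u) (add s' t)"
      by (rule cross_le) (use meet_t meet_u eq_iff in blast)+
    then show ?case by (simp add: cross_comm_right)
  next
    case (Join r r')
    then have "cross (Join (add r t) (add r' t)) (add s' u) (Join (add r u) (add r' u)) (add s' t)"
      by (intro cross_join) (simp_all add: cross_comm_right)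
    then have "cross (add (Join r r') t) (add s' u) (add (Join r r') u) (add s' t)"
      by (rule cross_le) (use join_t join_u eq_iff in blast)+
    then show ?case by (simp add: cross_comm_right)
  qed
qed

private lemma meet_join_le:
  assumes "Meet a c \<lesssim> z" "Meet a d \<lesssim> z"
  shows "Meet a (Join c d) \<lesssim> z"
  using distrib_meet_le join_lub[OF assms] by (rule le_trans)

private lemma join_meet_le:
  assumes "Meet a c \<lesssim> z" "Meet b c \<lesssim> z"
  shows "Meet (Join a b) c \<lesssim> z"
  by (rule le_trans[OF eq_le[OF comm_meet]], rule meet_join_le;
      rule le_trans[OF eq_le[OF comm_meet]], rule assms)

private lemma cross_absorb:
  assumes "cross x p q y"
  shows "Meet x p \<lesssim> Join (Meet x y) (Meet q p)"
proof -
  have "Meet x p \<lesssim> Meet (Meet x p) (Join q y)"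
    using le_refl assms unfolding cross_def by (rule meet_glb)
  also have "\<dots> \<lesssim> Join (Meet x y) (Meet q p)"
  proof (rule meet_join_le)
    have "Meet (Meet x p) q \<lesssim> Meet q p"
      by (rule meet_glb[OF meet_le2 le_trans[OF meet_le1 meet_le2]])
    then show "Meet (Meet x p) q \<lesssim> Join (Meet x y) (Meet q p)"
      using le_join2 by (rule le_trans)
    have "Meet (Meet x p) y \<lesssim> Meet x y"
      by (rule meet_mono[OF meet_le1 le_refl])
    then show "Meet (Meet x p) y \<lesssim> Join (Meet x y) (Meet q p)"
      using le_join1 by (rule le_trans)
  qed
  finally show ?thesis .
qed

private lemma meet_join_swap:
  assumes "cross x p q y" "cross q y x p"
  shows "Join (Meet x y) (Meet q p) \<approx> Meet (Join x q) (Join y p)"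
proof (rule le_antisym)
  show "Join (Meet x y) (Meet q p) \<lesssim> Meet (Join x q) (Join y p)"
    by (rule join_lub; rule meet_mono; rule le_join1 le_join2)
  have "Meet q y \<lesssim> Join (Meet q p) (Meet x y)"
    using assms(2) by (rule cross_absorb)
  then have "Meet q y \<lesssim> Join (Meet x y) (Meet q p)"
    using eq_le[OF comm_join] by (rule le_trans)
  then show "Meet (Join x q) (Join y p) \<lesssim> Join (Meet x y) (Meet q p)"
    by (intro meet_join_le join_meet_le cross_absorb assms(1) le_join1 le_join2)
qed

private lemma meet_meet_swap: "Meet (Meet x y) (Meet q p) \<approx> Meet (Meet x q) (Meet y p)"
  by (rule le_antisym; intro meet_glb)
    (rule le_trans[OF meet_le1 meet_le1] le_trans[OF meet_le1 meet_le2]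
      le_trans[OF meet_le2 meet_le1] le_trans[OF meet_le2 meet_le2])+

private lemma join_join_swap: "Join (Join x y) (Join q p) \<approx> Join (Join x q) (Join y p)"
  by (rule le_antisym; intro join_lub)
    (rule le_trans[OF le_join1 le_join1] le_trans[OF le_join2 le_join1]
      le_trans[OF le_join1 le_join2] le_trans[OF le_join2 le_join2])+

private lemma additive: "additive t"
proof (induction t)
  case (Gen b)
  show ?case by (simp add: additive_def lz_eq.refl)
next
  case (Meet t u)
  show ?case unfolding additive_def
  proof (intro allI conjI)
    fix s s'
    have "add (Meet s s') (Meet t u) \<approx>
        Meet (Meet (add s t) (add s' t)) (Meet (add s u) (add s' u))"
      using Meet by (simp add: additive_def cong_meet)
    also have "\<dots> \<approx> Meet (Meet (add s t) (add s u)) (Meet (add s' t) (add s' u))"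
      by (rule meet_meet_swap)
    finally show "add (Meet s s') (Meet t u) \<approx> Meet (add s (Meet t u)) (add s' (Meet t u))"
      by simp
    have "add (Join s s') (Meet t u) \<approx>
        Meet (Join (add s t) (add s' t)) (Join (add s u) (add s' u))"
      using Meet by (simp add: additive_def cong_meet)
    also have "\<dots> \<approx> Join (Meet (add s t) (add s u)) (Meet (add s' t) (add s' u))"
      by (rule lz_eq.sym, rule meet_join_swap)
        (use Meet cross_add cross_comm_right in blast)+
    finally show "add (Join s s') (Meet t u) \<approx> Join (add s (Meet t u)) (add s' (Meet t u))"
      by simp
  qed
next
  case (Join t u)
  show ?case unfolding additive_def
  proof (intro allI conjI)
    fix s s'
    have "add (Join s s') (Join t u) \<approx>
        Join (Join (add s t) (add s' t)) (Join (add s u) (add s' u))"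
      using Join by (simp add: additive_def cong_join)
    also have "\<dots> \<approx> Join (Join (add s t) (add s u)) (Join (add s' t) (add s' u))"
      by (rule join_join_swap)
    finally show "add (Join s s') (Join t u) \<approx> Join (add s (Join t u)) (add s' (Join t u))"
      by simp
    have "add (Meet s s') (Join t u) \<approx>
        Join (Meet (add s t) (add s' t)) (Meet (add s u) (add s' u))"
      using Join by (simp add: additive_def cong_join)
    also have "\<dots> \<approx> Meet (Join (add s t) (add s u)) (Join (add s' t) (add s' u))"
      by (rule lz_eq.trans[OF _ meet_join_swap])
        (use Join cross_add cross_comm_right cross_comm_left lz_eq.refl cross_swap in blast)+
    finally show "add (Meet s s') (Join t u) \<approx> Meet (add s (Join t u)) (add s' (Join t u))"
      by simp
  qed
qed

private lemma add_comm: "add s t \<approx> add t s"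
proof (induction t)
  case (Gen b)
  show ?case by (simp add: add_Gen lz_eq.refl)
next
  case (Meet t u)
  then have "add s (Meet t u) \<approx> Meet (add t s) (add u s)" by (simp add: cong_meet)
  also have "\<dots> \<approx> add (Meet t u) s" using additive additive_def lz_eq.sym by blast
  finally show ?case .
next
  case (Join t u)
  then have "add s (Join t u) \<approx> Join (add t s) (add u s)" by (simp add: cong_join)
  also have "\<dots> \<approx> add (Join t u) s" using additive additive_def lz_eq.sym by blast
  finally show ?case .
qed

private lemma add_cong: "s \<approx> s' \<Longrightarrow> t \<approx> t' \<Longrightarrow> add s t \<approx> add s' t'"
  by (meson add_comm add_cong1 lz_eq.trans)

private lemma add_neg: "add s (neg s) \<approx> Gen 0"
proof (induction s)
  case (Gen a)
  show ?case by (simp add: lz_eq.refl)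
next
  case (Meet u v)
  define x y q p where d: "x = add u (neg u)" "y = add v (neg u)"
    "q = add u (neg v)" "p = add v (neg v)"
  have "cross x p y q" "cross q y p x"
    unfolding d by (rule cross_add; rule additive)+
  then have eq: "Join (Meet x y) (Meet q p) \<approx> Meet (Join x q) (Join y p)"
    using meet_join_swap cross_comm_right by blast
  have xp: "x \<approx> Gen 0" "p \<approx> Gen 0" using Meet d by simp_all
  have "Join (Meet x y) (Meet q p) \<lesssim> Gen 0"
    using xp by (meson eq_iff join_lub meet_le1 meet_le2 le_trans)
  moreover have "Gen 0 \<lesssim> Meet (Join x q) (Join y p)"
    using xp by (meson eq_iff meet_glb le_join1 le_join2 le_trans)
  ultimately have "Join (Meet x y) (Meet q p) \<approx> Gen 0"
    using eq by (meson eq_iff le_trans)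
  moreover have "add (Meet u v) (neg (Meet u v)) \<approx> Join (Meet x y) (Meet q p)"
    using additive[of "neg u"] additive[of "neg v"] by (simp add: additive_def cong_join d)
  ultimately show ?case using lz_eq.trans by blast
next
  case (Join u v)
  define x y q p where d: "x = add u (neg u)" "y = add v (neg u)"
    "q = add u (neg v)" "p = add v (neg v)"
  have "cross x p y q" "cross q y p x"
    unfolding d by (rule cross_add; rule additive)+
  then have eq: "Join (Meet x q) (Meet y p) \<approx> Meet (Join x y) (Join q p)"
    using meet_join_swap cross_swap by (metis cross_comm_right)
  have xp: "x \<approx> Gen 0" "p \<approx> Gen 0" using Join d by simp_all
  have "Join (Meet x q) (Meet y p) \<lesssim> Gen 0"
    using xp by (meson eq_iff join_lub meet_le1 meet_le2 le_trans)
  moreover have "Gen 0 \<lesssim> Meet (Join x y) (Join q p)"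
    using xp by (meson eq_iff meet_glb le_join1 le_join2 le_trans)
  ultimately have "Meet (Join x y) (Join q p) \<approx> Gen 0"
    using eq by (meson eq_iff le_trans)
  moreover have "add (Join u v) (neg (Join u v)) \<approx> Meet (Join x y) (Join q p)"
    using additive[of "neg u"] additive[of "neg v"] by (simp add: additive_def cong_meet d)
  ultimately show ?case using lz_eq.trans by blast
qed

private abbreviation cls where "cls t \<equiv> lz_rel R `` {t}"

private lemma equiv: "equiv UNIV (lz_rel R)"
  by (rule equivI) (auto simp: lz_rel_def refl_on_def sym_def trans_def
      intro: lz_eq.refl lz_eq.sym lz_eq.trans)

private lemma cls_eq_iff: "cls s = cls t \<longleftrightarrow> s \<approx> t"
  using eq_equiv_class_iff[OF equiv] by (simp add: lz_rel_def)

private lemma carrierE: assumes "X \<in> lz_carrier R" obtains t where "X = cls t"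
  using assms unfolding lz_carrier_def by (rule quotientE)

private lemma cls_carrier: "cls t \<in> lz_carrier R"
  unfolding lz_carrier_def by (rule quotientI) simp

private lemma lz_meet_cls: "lz_meet R (cls s) (cls t) = cls (Meet s t)"
proof -
  have "lz_meet R (cls s) (cls t) = (\<Union>s'\<in>cls s. \<Union>t'\<in>cls t. cls (Meet s t))"
    unfolding lz_meet_def
  proof (intro SUP_cong HOL.refl)
    fix s' t' assume "s' \<in> cls s" "t' \<in> cls t"
    then have "Meet s' t' \<approx> Meet s t" by (auto simp: lz_rel_def intro: cong_meet lz_eq.sym)
    then show "cls (Meet s' t') = cls (Meet s t)" by (simp only: cls_eq_iff)
  qed
  also have "\<dots> = cls (Meet s t)" by (auto simp: lz_rel_def intro: lz_eq.refl)
  finally show ?thesis .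
qed

private lemma lz_join_cls: "lz_join R (cls s) (cls t) = cls (Join s t)"
proof -
  have "lz_join R (cls s) (cls t) = (\<Union>s'\<in>cls s. \<Union>t'\<in>cls t. cls (Join s t))"
    unfolding lz_join_def
  proof (intro SUP_cong HOL.refl)
    fix s' t' assume "s' \<in> cls s" "t' \<in> cls t"
    then have "Join s' t' \<approx> Join s t" by (auto simp: lz_rel_def intro: cong_join lz_eq.sym)
    then show "cls (Join s' t') = cls (Join s t)" by (simp only: cls_eq_iff)
  qed
  also have "\<dots> = cls (Join s t)" by (auto simp: lz_rel_def intro: lz_eq.refl)
  finally show ?thesis .
qed

private definition law where
  "law X Y = (if X \<in> lz_carrier R \<and> Y \<in> lz_carrier R
     then cls (add (SOME s. X = cls s) (SOME t. Y = cls t)) else undefined)"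

private lemma law_cls: "law (cls s) (cls t) = cls (add s t)"
proof -
  define s' t' where "s' = (SOME s'. cls s = cls s')" and "t' = (SOME t'. cls t = cls t')"
  have "cls s = cls s'" "cls t = cls t'"
    unfolding s'_def t'_def by (rule someI, rule HOL.refl)+
  then have "add s' t' \<approx> add s t"
    unfolding cls_eq_iff by (metis add_cong lz_eq.sym)
  then show ?thesis
    unfolding law_def s'_def[symmetric] t'_def[symmetric]
    by (simp only: cls_carrier cls_eq_iff simp_thms if_True)
qed

private lemma law: "lz_group_law R law"
proof -
  have "comm_group \<lparr>carrier = lz_carrier R, mult = law, one = lz_gen R 0\<rparr>" (is "comm_group ?H")
  proof (rule comm_groupI)
    fix x y assume "x \<in> carrier ?H" "y \<in> carrier ?H"
    then obtain s t where "x = cls s" "y = cls t" by (auto elim!: carrierE)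
    then show "x \<otimes>\<^bsub>?H\<^esub> y \<in> carrier ?H" "x \<otimes>\<^bsub>?H\<^esub> y = y \<otimes>\<^bsub>?H\<^esub> x"
      by (simp_all only: law_cls cls_carrier cls_eq_iff add_comm monoid.simps partial_object.simps)
  next
    fix x y z assume "x \<in> carrier ?H" "y \<in> carrier ?H" "z \<in> carrier ?H"
    then show "x \<otimes>\<^bsub>?H\<^esub> y \<otimes>\<^bsub>?H\<^esub> z = x \<otimes>\<^bsub>?H\<^esub> (y \<otimes>\<^bsub>?H\<^esub> z)"
      by (auto elim!: carrierE simp: law_cls add_assoc)
  next
    fix x assume x: "x \<in> carrier ?H"
    then show "\<one>\<^bsub>?H\<^esub> \<otimes>\<^bsub>?H\<^esub> x = x"
      by (auto elim!: carrierE simp: law_cls lz_gen_def add_Gen shift_zero)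
    from x obtain t where "x = cls t" by (auto elim!: carrierE)
    then have "cls (neg t) \<in> carrier ?H" "cls (neg t) \<otimes>\<^bsub>?H\<^esub> x = \<one>\<^bsub>?H\<^esub>"
      using add_neg[of t] add_comm[of "neg t" t] lz_eq.trans
      by (auto simp: law_cls cls_carrier cls_eq_iff lz_gen_def)
    then show "\<exists>y\<in>carrier ?H. y \<otimes>\<^bsub>?H\<^esub> x = \<one>\<^bsub>?H\<^esub>" by blast
  qed (simp add: lz_gen_def cls_carrier)
  moreover have "lz_gen R \<in> hom additive_group ?H"
    by (auto simp: hom_def additive_group_def lz_gen_def cls_carrier law_cls add.commute)
  ultimately show ?thesis
    unfolding lz_group_law_def Let_def
    by (auto elim!: carrierE simp: law_cls lz_meet_cls lz_join_cls)
      (auto simp: law_def)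
qed

private lemma law_unique: assumes "lz_group_law R f" shows "f = law"
proof -
  let ?H = "\<lparr>carrier = lz_carrier R, mult = f, one = lz_gen R 0\<rparr>"
  interpret comm_group ?H
    using assms by (simp add: lz_group_law_def Let_def)
  have gen: "f (cls (Gen a)) (cls (Gen b)) = cls (Gen (a + b))" for a b
    using assms by (simp add: lz_group_law_def Let_def hom_def additive_group_def lz_gen_def)
  have dist: "f (cls s) (cls (Meet t u)) = lz_meet R (f (cls s) (cls t)) (f (cls s) (cls u))"
    "f (cls s) (cls (Join t u)) = lz_join R (f (cls s) (cls t)) (f (cls s) (cls u))" for s t u
    using assms cls_carrier
    by (simp_all add: lz_group_law_def Let_def flip: lz_meet_cls lz_join_cls)
  have comm: "f (cls s) (cls t) = f (cls t) (cls s)" for s t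
    using m_comm[of "cls s" "cls t"] by (simp add: cls_carrier)
  have Gen: "f (cls s) (cls (Gen b)) = cls (shift b s)" for s b
  proof (induction s)
    case (Gen a)
    show ?case by (simp add: gen add.commute)
  next
    case (Meet s t)
    then show ?case
      by (subst comm) (simp add: dist lz_meet_cls comm[of "Gen b"])
  next
    case (Join s t)
    then show ?case
      by (subst comm) (simp add: dist lz_join_cls comm[of "Gen b"])
  qed
  have "f (cls s) (cls t) = cls (add s t)" for s t
    by (induction t) (simp_all add: Gen dist lz_meet_cls lz_join_cls)
  then have on: "f X Y = law X Y" if "X \<in> lz_carrier R" "Y \<in> lz_carrier R" for X Y
    using that by (auto elim!: carrierE simp: law_cls)
  have off: "f X Y = law X Y" if "X \<notin> lz_carrier R \<or> Y \<notin> lz_carrier R" for X Y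
    using assms law that by (simp add: lz_group_law_def Let_def)
  show ?thesis using on off by blast
qed

lemma lz_group_law_ex1: "\<exists>!f. lz_group_law R f"
  using law law_unique by blast

end

end

end

(* If a is not below b in the regularisation, then a compactness argument makes one choice of sign
   for all elements of G at once, in such a way that the system of ideals forced by it still does
   not contain a - b \<rhd> 0. This system restricts to a translation invariant total preorder on G, for
   which A \<rhd> c means that some element of A lies below c. Hence A \<turnstile> B implies that some element of
   A lies below some element of B, and the upper set of a defines a lattice morphism from H to the
   two-element lattice, which separates a from b. *)

theory Submission
  imports Defs
begin

section \<open>Compactness for choices of signs\<close>

abbreviation signs :: "'a::uminus list \<Rightarrow> 'a list \<Rightarrow> bool" where
  "signs ys xs \<equiv> list_all2 (\<lambda>y x. y = x \<or> y = - x) ys xs"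

text \<open>A derivation is a finite binary tree that branches on the sign of one element at each
  node; \<open>Q\<close> holds at every leaf, that is for \<open>Y\<close> enlarged by the signed
  elements along the branch.\<close>

inductive sign_cover :: "('a::uminus set \<Rightarrow> bool) \<Rightarrow> 'a set \<Rightarrow> bool" for Q where
  base: "Q Y \<Longrightarrow> sign_cover Q Y"
| split: "sign_cover Q (insert x Y) \<Longrightarrow> sign_cover Q (insert (- x) Y) \<Longrightarrow> sign_cover Q Y"

lemma sign_cover_mono:
  assumes "mono Q" "sign_cover Q Y" "Y \<subseteq> Z"
  shows "sign_cover Q Z"
  using assms(2,3)
proof (induction arbitrary: Z)
  case (base Y)
  then have "Q Z" using assms(1) by (auto dest: monoD)
  then show ?case by (rule sign_cover.base)
next
  case (split x Y)
  then show ?case by (metis insert_mono sign_cover.split)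
qed

text \<open>A tree has finitely many leaves, and each of them uses only finitely many elements of
  \<open>Y\<close>. This makes the union of a chain of uncovered sets uncovered.\<close>

lemma sign_cover_finite:
  assumes mono: "mono Q"
    and finitary: "\<forall>Y. Q Y \<longrightarrow> (\<exists>Z\<subseteq>Y. finite Z \<and> Q Z)"
    and "sign_cover Q Y"
  shows "\<exists>Z\<subseteq>Y. finite Z \<and> sign_cover Q Z"
  using assms(3)
proof induction
  case (base Y)
  then show ?case using finitary sign_cover.base by metis
next
  case (split x Y)
  then obtain U V where UV: "U \<subseteq> insert x Y" "finite U" "sign_cover Q U"
    "V \<subseteq> insert (- x) Y" "finite V" "sign_cover Q V"
    by blast
  \<comment> \<open>The split element is removed since it need not lie in \<open>Y\<close>;
    \<open>split\<close> puts it back.\<close>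
  let ?Z = "(U - {x}) \<union> (V - {- x})"
  have "sign_cover Q (insert x ?Z)" "sign_cover Q (insert (- x) ?Z)"
    by (rule sign_cover_mono[OF mono UV(3)] sign_cover_mono[OF mono UV(6)]; blast)+
  then have "sign_cover Q ?Z" by (rule sign_cover.split)
  moreover have "?Z \<subseteq> Y" "finite ?Z" using UV by auto
  ultimately show ?case by blast
qed

text \<open>The list collects the elements at all nodes of the tree. A choice of signs for it
  selects a branch, and the signs chosen off this branch only enlarge the set, which is harmless
  because \<open>Q\<close> is monotone.\<close>

lemma sign_cover_list:
  assumes mono: "mono Q"
    and "sign_cover Q Y"
  shows "\<exists>xs. \<forall>ys. signs ys xs \<longrightarrow> Q (Y \<union> set ys)"
  using assms(2)
proof induction
  case (base Y)
  then have "Q (Y \<union> set ys)" for ys using monoD[OF mono, of Y] by auto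
  then show ?case by blast
next
  case (split x Y)
  then obtain us vs where us: "\<And>ys. signs ys us \<Longrightarrow> Q (insert x Y \<union> set ys)"
    and vs: "\<And>ys. signs ys vs \<Longrightarrow> Q (insert (- x) Y \<union> set ys)"
    by blast
  have "Q (Y \<union> set ys)" if ys: "signs ys (x # us @ vs)" for ys
  proof -
    from ys obtain y zs ws where d: "ys = y # zs @ ws" "y = x \<or> y = - x" "signs zs us" "signs ws vs"
      by (auto simp: list_all2_Cons2 list_all2_append2)
    from d(2) show ?thesis
    proof
      assume "y = x"
      with d(1) show ?thesis using us[OF d(3)] monoD[OF mono, of "(insert x Y) \<union> set zs" "Y \<union> set ys"]
        by auto
    next
      assume "y = - x"
      with d(1) show ?thesis using vs[OF d(4)] monoD[OF mono, of "(insert (- x) Y) \<union> set ws" "Y \<union> set ys"]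
        by auto
    qed
  qed
  then show ?case by blast
qed

lemma sign_choice_compactness:
  fixes Q :: "'a::uminus set \<Rightarrow> bool"
  assumes mono: "mono Q"
    and finitary: "\<forall>Y. Q Y \<longrightarrow> (\<exists>Z\<subseteq>Y. finite Z \<and> Q Z)"
    and total: "\<And>Y. \<forall>x. x \<in> Y \<or> - x \<in> Y \<Longrightarrow> Q Y"
  shows "\<exists>xs. \<forall>ys. signs ys xs \<longrightarrow> Q (set ys)"
proof -
  have "sign_cover Q {}"
  proof (rule ccontr)
    assume none: "\<not> sign_cover Q {}"
    have "\<exists>M\<in>{Y. \<not> sign_cover Q Y}. \<forall>X\<in>{Y. \<not> sign_cover Q Y}. M \<subseteq> X \<longrightarrow> X = M"
    proof (rule subset_Zorn_nonempty)
      show "{Y. \<not> sign_cover Q Y} \<noteq> {}" using none by blast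
      fix C assume C: "C \<noteq> {}" "subset.chain {Y. \<not> sign_cover Q Y} C"
      have "\<not> sign_cover Q (\<Union>C)"
      proof
        assume "sign_cover Q (\<Union>C)"
        from sign_cover_finite[OF mono finitary this]
        obtain Z where Z: "Z \<subseteq> \<Union>C" "finite Z" "sign_cover Q Z"
          by auto
        from C Z(1,2) obtain Y where "Y \<in> C" "Z \<subseteq> Y"
          by (metis finite_subset_Union_chain)
        from sign_cover_mono[OF mono Z(3) this(2)] have "sign_cover Q Y" .
        with \<open>Y \<in> C\<close> C(2) show False by (auto simp: subset.chain_def)
      qed
      then show "\<Union>C \<in> {Y. \<not> sign_cover Q Y}" by simp
    qed
    then obtain M where M: "\<not> sign_cover Q M"
      and max: "\<And>X. \<not> sign_cover Q X \<Longrightarrow> M \<subseteq> X \<Longrightarrow> X = M"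
      by blast
    \<comment> \<open>If neither sign of \<open>x\<close> were in \<open>M\<close>, both insertions
      would be proper extensions of \<open>M\<close>, hence covered, and \<open>split\<close> would
      cover \<open>M\<close>.\<close>
    have "x \<in> M \<or> - x \<in> M" for x
      using M max sign_cover.split by (metis insertI1 subset_insertI)
    then have "Q M" using total by blast
    with M show False using sign_cover.base by blast
  qed
  from sign_cover_list[OF mono this] show ?thesis by simp
qed

section \<open>Finite support of forced systems\<close>

lemma forced_mono: "forced R Y A b \<Longrightarrow> Y \<subseteq> Z \<Longrightarrow> forced R Z A b"
  unfolding forced_def by blast

text \<open>As \<open>forced\<close> is an intersection, there is no derivation to inspect. Instead,
  the consequences of finite subsets of \<open>Y\<close> are shown to form a system of ideals that
  meets all requirements, so that this system contains \<open>forced R Y\<close>.\<close>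

lemma forced_finitary:
  assumes sys: "system_of_ideals R" and "forced R Y A b"
  shows "\<exists>Z\<subseteq>Y. finite Z \<and> forced R Z A b"
proof -
  define S where "S A b \<longleftrightarrow> (\<exists>Z\<subseteq>Y. finite Z \<and> forced R Z A b)" for A b
  note fsys = forced_finest(1)[OF sys]
  have "system_of_ideals S"
  proof
    fix A b assume "S A b"
    then show "finite A \<and> A \<noteq> {}"
      unfolding S_def using system_of_ideals.fin_nonempty[OF fsys] by blast
  next
    fix a show "S {a} a"
      unfolding S_def using system_of_ideals.reflexive[OF fsys] by blast
  next
    fix A A' :: "'a set" and b assume "S A b" "finite A'" "A' \<noteq> {}"
    then show "S (A \<union> A') b"
      unfolding S_def using system_of_ideals.weakening[OF fsys] by meson
  next
    fix A c b assume "S A c" "S (A \<union> {c}) b"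
    then obtain U V where UV: "U \<subseteq> Y" "finite U" "forced R U A c"
      "V \<subseteq> Y" "finite V" "forced R V (A \<union> {c}) b"
      unfolding S_def by blast
    have "forced R (U \<union> V) A b"
      using system_of_ideals.transitive[OF fsys] forced_mono[OF UV(3)] forced_mono[OF UV(6)]
      by (metis sup_ge1 sup_ge2)
    with UV show "S A b" unfolding S_def by (metis Un_least finite_UnI)
  next
    fix a b :: 'a assume "a \<le> b"
    then show "S {a} b"
      unfolding S_def using system_of_ideals.order[OF fsys] by blast
  next
    fix A b x assume "S A b"
    then show "S ((+) x ` A) (x + b)"
      unfolding S_def using system_of_ideals.translation[OF fsys] by meson
  qed
  moreover have "coarser_than S R"
    using forced_finest(2)[OF sys] unfolding coarser_than_def S_def by blast
  moreover have "S {0} y" if "y \<in> Y" for y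
    using forced_finest(3)[OF sys, of y "{y}"] that unfolding S_def by blast
  ultimately have "S A b" using assms(2) unfolding forced_def by blast
  then show ?thesis by (simp add: S_def)
qed

section \<open>Total systems of ideals\<close>

context system_of_ideals
begin

lemma single_trans: "{a} \<rhd> b \<Longrightarrow> {b} \<rhd> c \<Longrightarrow> {a} \<rhd> c"
  using transitive[of "{a}" b c] weakening[of "{b}" c "{a}"] by (simp add: insert_commute)

lemma single_translate: "{a} \<rhd> b \<longleftrightarrow> {x + a} \<rhd> x + b"
  using translation[of "{a}" b x] translation[of "{x + a}" "x + b" "- x"] by auto

lemma cut_finite:
  assumes "finite B" "\<forall>x\<in>B. A \<rhd> x" "A \<union> B \<rhd> c"
  shows "A \<rhd> c"
  using assms
proof (induction B)
  case empty
  then show ?case by simp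
next
  case (insert x B)
  show ?case
  \<comment> \<open>The empty case is separate because \<open>weakening\<close> adds only nonempty
    sets.\<close>
  proof (cases "B = {}")
    case True
    then show ?thesis using insert.prems transitive by auto
  next
    case False
    have "A \<union> B \<rhd> x"
      using weakening insert.prems(1) insert.hyps(1) False by blast
    moreover have "(A \<union> B) \<union> {x} \<rhd> c" using insert.prems(2) by simp
    ultimately have "A \<union> B \<rhd> c" by (rule transitive)
    then show ?thesis using insert by blast
  qed
qed

text \<open>By translation, totality at 0 makes the relation between singletons a total preorder.
  The finite set \<open>A\<close> then has a least element, from which all others follow and can be
  cut.\<close>

lemma total_dominated:
  assumes total: "\<And>x. {0} \<rhd> x \<or> {0} \<rhd> - x" and "A \<rhd> c"
  shows "\<exists>a\<in>A. {a} \<rhd> c"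
proof -
  have linear: "{x} \<rhd> y \<or> {y} \<rhd> x" for x y
    using total[of "y - x"] single_translate[of 0 "y - x" x] single_translate[of 0 "x - y" y]
    by simp
  have fin: "finite A" "A \<noteq> {}" using fin_nonempty[OF \<open>A \<rhd> c\<close>] by simp_all
  then have "\<exists>m\<in>A. \<forall>x\<in>A. {m} \<rhd> x"
  proof (induction rule: finite_ne_induct)
    case (singleton x)
    then show ?case using reflexive by simp
  next
    case (insert x F)
    then obtain m where m: "m \<in> F" "\<forall>y\<in>F. {m} \<rhd> y" by blast
    from linear[of x m] show ?case
    proof
      assume "{x} \<rhd> m"
      then show ?thesis using m single_trans reflexive by blast
    next
      assume "{m} \<rhd> x"
      then show ?thesis using m by blast
    qed
  qed
  then obtain m where m: "m \<in> A" "\<forall>x\<in>A. {m} \<rhd> x" by blast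
  \<comment> \<open>The cut starts from \<open>{m}\<close> and eliminates all of \<open>A\<close>,
    where \<open>{m} \<union> A = A\<close>.\<close>
  then have "{m} \<rhd> c"
    using cut_finite[of A "{m}" c] fin \<open>A \<rhd> c\<close> by (simp add: insert_absorb)
  with m show ?thesis by blast
qed

lemma regularisation_total:
  assumes sys: "system_of_ideals R0" and coarser: "coarser_than R R0"
    and total: "\<And>x. {0} \<rhd> x \<or> {0} \<rhd> - x"
    and reg: "regularisation R0 A B"
  shows "\<exists>a\<in>A. \<exists>b\<in>B. {a} \<rhd> b"
proof -
  from reg obtain xs where xs:
    "\<And>ys. signs ys xs \<Longrightarrow> forced R0 (set ys) {a - b | a b. a \<in> A \<and> b \<in> B} 0"
    unfolding regularisation_def by blast
  \<comment> \<open>Each sign is chosen so that the forced relation already holds in the given total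
    system, which is therefore coarser than the forced one.\<close>
  define ys where "ys = map (\<lambda>x. if {0} \<rhd> x then x else - x) xs"
  have "signs ys xs" by (simp add: ys_def list_all2_map1 list.rel_refl)
  moreover have "\<forall>y\<in>set ys. {0} \<rhd> y" using total by (auto simp: ys_def)
  ultimately have "{a - b | a b. a \<in> A \<and> b \<in> B} \<rhd> 0"
    using forced_finest(4)[OF sys system_of_ideals_axioms coarser] xs
    unfolding coarser_than_def by blast
  from total_dominated[OF total this] obtain a b
    where "a \<in> A" "b \<in> B" "{a - b} \<rhd> 0"
    by blast
  then show ?thesis using single_translate[of "a - b" 0 b] by auto
qed

end

text \<open>A set \<open>Y\<close> that contains a sign of every element forces a total system, to
  which the assumption applies; compactness then reduces \<open>Y\<close> to the signs of a finite
  list.\<close>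

lemma regularisation_singletonI:
  assumes sys: "system_of_ideals R"
    and total: "\<And>S. system_of_ideals S \<Longrightarrow> coarser_than S R \<Longrightarrow> (\<And>x. S {0} x \<or> S {0} (- x)) \<Longrightarrow> S {a} b"
  shows "regularisation R {a} {b}"
proof -
  have "\<exists>xs. \<forall>ys. signs ys xs \<longrightarrow> forced R (set ys) {a - b} 0"
  proof (rule sign_choice_compactness)
    show "mono (\<lambda>Y. forced R Y {a - b} 0)"
      by (rule monoI) (use forced_mono in \<open>auto simp: le_bool_def\<close>)
    show "\<forall>Y. forced R Y {a - b} 0 \<longrightarrow> (\<exists>Z\<subseteq>Y. finite Z \<and> forced R Z {a - b} 0)"
      using forced_finitary[OF sys] by blast
  next
    fix Y :: "'a set" assume Y: "\<forall>x. x \<in> Y \<or> - x \<in> Y"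
    interpret F: system_of_ideals "forced R Y" by (rule forced_finest(1)[OF sys])
    have "forced R Y {0} x \<or> forced R Y {0} (- x)" for x
      using Y forced_finest(3)[OF sys, of x Y] forced_finest(3)[OF sys, of "- x" Y] by blast
    with F.system_of_ideals_axioms forced_finest(2)[OF sys] have "forced R Y {a} b"
      by (rule total)
    then show "forced R Y {a - b} 0"
      using F.single_translate[of a b "- b"] by simp
  qed
  then show ?thesis by (simp add: regularisation_def)
qed

section \<open>Order between generators of the lattice\<close>

primrec holds :: "('a \<Rightarrow> bool) \<Rightarrow> 'a lterm \<Rightarrow> bool" where
  "holds v (Gen a) = v a"
| "holds v (Meet s t) = (holds v s \<and> holds v t)"
| "holds v (Join s t) = (holds v s \<or> holds v t)"

lemma holds_meets: "holds v (meets a as) \<longleftrightarrow> (\<forall>x\<in>set (a # as). v x)"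
  unfolding meets_def by (induction as) auto

lemma holds_joins: "holds v (joins a as) \<longleftrightarrow> (\<exists>x\<in>set (a # as). v x)"
  unfolding joins_def by (induction as) auto

text \<open>The truth values form a distributive lattice, so only the relations of the presentation
  need the assumption on \<open>v\<close>.\<close>

lemma lz_eq_holds:
  assumes "\<And>A B. regularisation R A B \<Longrightarrow> \<forall>a\<in>A. v a \<Longrightarrow> \<exists>b\<in>B. v b"
    and "lz_eq R s t"
  shows "holds v s = holds v t"
  using assms(2)
proof induction
  case (relation a as b bs)
  from assms(1)[OF this] show ?case
    by (simp add: holds_meets holds_joins del: list.set) blast
qed auto

lemma regularisation_if_le:
  assumes sys: "system_of_ideals R" and le: "lz_eq R (Meet (Gen a) (Gen b)) (Gen a)"
  shows "regularisation R {a} {b}"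
proof (rule regularisation_singletonI[OF sys])
  fix S assume S: "system_of_ideals S" "coarser_than S R" "\<And>x. S {0} x \<or> S {0} (- x)"
  then interpret S: system_of_ideals S by simp
  \<comment> \<open>The upper set of \<open>a\<close> respects the relations: some element of
    \<open>A\<close> lies below some element of \<open>B\<close>, and \<open>a\<close> lies below
    the former.\<close>
  have "\<exists>d\<in>B. S {a} d" if "regularisation R A B" "\<forall>c\<in>A. S {a} c" for A B
    using S.regularisation_total[OF sys S(2,3) that(1)] that(2) S.single_trans by blast
  from lz_eq_holds[of R "\<lambda>c. S {a} c", OF this le]
  show "S {a} b" using S.reflexive by simp
qed

text \<open>Every forced system contains the order, in particular a - b \<le> 0, so any list of
  elements witnesses the regularisation.\<close>

lemma le_if_le:
  assumes sys: "system_of_ideals R" and "a \<le> b"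
  shows "lz_eq R (Meet (Gen a) (Gen b)) (Gen a)"
proof -
  have "forced R (set ys) {a - b} 0" for ys
    using system_of_ideals.order[OF forced_finest(1)[OF sys]] \<open>a \<le> b\<close> by simp
  then have "regularisation R (set [a]) (set [b])"
    by (simp add: regularisation_def)
  then show ?thesis
    using lz_eq.relation[of R a "[]" b "[]"] by (simp add: meets_def joins_def)
qed

lemma equiv_lz_rel: "equiv UNIV (lz_rel R)"
  by (rule equivI) (auto simp: lz_rel_def refl_on_def sym_def trans_def
      intro: lz_eq.refl lz_eq.sym lz_eq.trans)

lemma lz_meet_gen: "lz_meet R (lz_gen R a) (lz_gen R b) = lz_rel R `` {Meet (Gen a) (Gen b)}"
proof -
  have "(\<lambda>s t. lz_rel R `` {Meet s t}) respects2 lz_rel R"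
  proof (rule congruent2I')
    fix s s' t t' assume "(s, s') \<in> lz_rel R" "(t, t') \<in> lz_rel R"
    then have "(Meet s t, Meet s' t') \<in> lz_rel R"
      by (simp add: lz_rel_def cong_meet)
    then show "lz_rel R `` {Meet s t} = lz_rel R `` {Meet s' t'}"
      by (rule equiv_class_eq[OF equiv_lz_rel])
  qed
  then show ?thesis
    unfolding lz_meet_def lz_gen_def
    by (simp add: UN_equiv_class2[OF equiv_lz_rel equiv_lz_rel])
qed

lemma lgroup_le_gen_iff:
  "lgroup_le (lorenzen_group R) (lz_gen R a) (lz_gen R b) \<longleftrightarrow> lz_eq R (Meet (Gen a) (Gen b)) (Gen a)"
  using eq_equiv_class_iff[OF equiv_lz_rel, of "Meet (Gen a) (Gen b)" "Gen a" R]
  by (simp add: lgroup_le_def lorenzen_group_def lz_meet_gen)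
    (simp add: lz_gen_def lz_rel_def)

lemma lz_gen_hom:
  assumes "system_of_ideals R"
  shows "lz_gen R \<in> hom additive_group (lorenzen_group R)"
proof -
  have "lz_group_law R (THE f. lz_group_law R f)"
    by (rule theI'[OF lz_group_law_ex1[OF assms]])
  then have "lz_gen R \<in> hom additive_group
      \<lparr>carrier = lz_carrier R, mult = (THE f. lz_group_law R f), one = lz_gen R 0\<rparr>"
    unfolding lz_group_law_def[of R "The (lz_group_law R)"] Let_def by blast
  \<comment> \<open>\<open>hom\<close> looks only at carrier and multiplication, so the lattice
    fields of the larger record do not matter.\<close>
  then show ?thesis by (simp add: lorenzen_group_def hom_def)
qed

theorem theorem4p9:
  fixes R :: "'a::ordered_ab_group_add set \<Rightarrow> 'a \<Rightarrow> bool"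
  assumes "system_of_ideals R"
    and "ideal_closed R"
  shows "lz_gen R \<in> hom additive_group (lorenzen_group R)
    \<and> inj (lz_gen R)
    \<and> (\<forall>a b. a \<le> b \<longleftrightarrow> lgroup_le (lorenzen_group R) (lz_gen R a) (lz_gen R b))"
proof -
  have le: "a \<le> b \<longleftrightarrow> lgroup_le (lorenzen_group R) (lz_gen R a) (lz_gen R b)" for a b
    using regularisation_if_le[OF assms(1)] le_if_le[OF assms(1)] assms(2)
    unfolding ideal_closed_def lgroup_le_gen_iff by blast
  moreover have "inj (lz_gen R)"
    by (rule injI) (metis le order.refl order.antisym)
  ultimately show ?thesis using lz_gen_hom[OF assms(1)] by blast
qed

end
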